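(* Let $D\subseteq\mathbb{R}^d$ be open and $f:D\to\mathbb{R}^d$ locally Lipschitz. Let $x^*\in D$ be an equilibrium of $\dot x=f(x)$ that is $\lambda$-exponentially stable on a compact set $S\subseteq D$ with $x^*\in\mathrm{int}(S)$, with constants $C\ge1$ and $\lambda>0$. Let $r,R>0$ satisfy $B_r(x^* )\subseteq S\subseteq B_R(x^* )$. Then for any $0<\alpha<\lambda$ and any $\varepsilon\ge0$ such that $B_\varepsilon(x^* )\subset\mathrm{int}(S)$, the function $V(x):=\|x-x^*\|$ is an $\varepsilon$-Exponential Recurrent Lyapunov Function ($\varepsilon$-ERLF) over $S$ with parameters $(\alpha,\tau)$ for any $\tau>0$ satisfying $$\tau\ \ge\ \frac{1}{\lambda-\alpha}\ln\!\left(C\,\frac{R}{r}\right).$$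
   Context: $\|\cdot\|$ is a fixed norm on $\mathbb{R}^d$ and $B_r(x)$ is the closed ball of radius $r$ around $x$ (with $B_0(x^* )=\{x^*\}$). Locally Lipschitz means: for every compact $K\subset D$ there is $\overline L_K\ge 0$ with $\|f(y)-f(x)\|\le \overline L_K\|y-x\|$ for all $x,y\in K$. For $x\in D$, $\phi(t,x)$ is the solution of $\dot x=f(x)$ with $\phi(0,x)=x$, on its maximal open interval of existence $I(x)\ni 0$. Assertions about $\phi(t,x)$ for all $t\ge0$ include existence of the solution for all $t\ge0$. $\lambda$-exponentially stable on $S$ with constants $C\ge1$, $\lambda>0$: $\|\phi(t,x)-x^*\|\le Ce^{-\lambda t}\|x-x^*\|$ for all $x\in S$ and all $t\ge0$. Containment times: $T_S(x;\tau):=\{t\in(0,\tau]: \phi(t,x)\in S\}$ (with $t\in I(x)$). An inequality $\min_{s\in T_S(x;\tau)}g(s)\le c$ means that there is $s\in T_S(x;\tau)$ with $g(s)\le c$. $\varepsilon$-ERLF: given $\varepsilon\ge0$ with $B_\varepsilon(x^* )\subset\mathrm{int}(S)$ and $\alpha,\tau>0$, a continuous $V:D\to\mathbb{R}_{\ge0}$ is an $\varepsilon$-ERLF over $S$ with parameters $(\alpha,\tau)$ if (i) there are $a_1,a_2>0$ with $a_1\|x-x^*\|\le V(x)\le a_2\|x-x^*\|$ for all $x\in S$; (ii) $\min_{s\in T_S(x;\tau)}e^{\alpha s}V(\phi(s,x))\le V(x)$ for all $x\in K_\varepsilon:=\mathrm{cl}(S\setminus B_\varepsilon(x^* ))$.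 *)

theory Defs
  imports "HOL-Analysis.Analysis"
begin

text \<open>An arbitrary norm on the finite-dimensional space is given as a function. Topological notions
  (compactness, interior, closure, continuity) and derivatives are the library ones; since all norms
  on a finite-dimensional space are equivalent, they do not depend on the norm chosen.\<close>

definition is_norm :: "(real ^ 'n \<Rightarrow> real) \<Rightarrow> bool" where
  "is_norm nrm \<longleftrightarrow>
     (\<forall>x. 0 \<le> nrm x) \<and> (\<forall>x. nrm x = 0 \<longleftrightarrow> x = 0) \<and>
     (\<forall>c x. nrm (c *\<^sub>R x) = \<bar>c\<bar> * nrm x) \<and>
     (\<forall>x y. nrm (x + y) \<le> nrm x + nrm y)"

definition nball :: "(real ^ 'n \<Rightarrow> real) \<Rightarrow> real ^ 'n \<Rightarrow> real \<Rightarrow> (real ^ 'n) set" where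
  "nball nrm x r = {y. nrm (y - x) \<le> r}"

definition locally_lipschitz ::
  "(real ^ 'n \<Rightarrow> real) \<Rightarrow> (real ^ 'n) set \<Rightarrow> (real ^ 'n \<Rightarrow> real ^ 'n) \<Rightarrow> bool" where
  "locally_lipschitz nrm D f \<longleftrightarrow>
     (\<forall>K. compact K \<and> K \<subseteq> D \<longrightarrow>
        (\<exists>L\<ge>0. \<forall>x\<in>K. \<forall>y\<in>K. nrm (f y - f x) \<le> L * nrm (y - x)))"

definition ivp_solution ::
  "(real ^ 'n) set \<Rightarrow> (real ^ 'n \<Rightarrow> real ^ 'n) \<Rightarrow> real ^ 'n \<Rightarrow> real set \<Rightarrow> (real \<Rightarrow> real ^ 'n) \<Rightarrow> bool" where
  "ivp_solution D f x J u \<longleftrightarrow>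
     open J \<and> is_interval J \<and> 0 \<in> J \<and> u 0 = x \<and>
     (\<forall>t\<in>J. u t \<in> D \<and> (u has_vector_derivative f (u t)) (at t))"

text \<open>By uniqueness of solutions (\<open>f\<close> locally Lipschitz on the open set \<open>D\<close>), solutions on different
  open intervals agree where both are defined. Hence the maximal interval of existence is the union
  of all solution intervals, and the maximal solution takes at each time in it the common value of
  all solutions. Outside the maximal interval \<open>flow\<close> carries no information, so every use below is
  guarded by membership in \<open>exist_interval\<close>.\<close>

definition exist_interval ::
  "(real ^ 'n) set \<Rightarrow> (real ^ 'n \<Rightarrow> real ^ 'n) \<Rightarrow> real ^ 'n \<Rightarrow> real set" where
  "exist_interval D f x = \<Union>{J. \<exists>u. ivp_solution D f x J u}"

definition flow ::
  "(real ^ 'n) set \<Rightarrow> (real ^ 'n \<Rightarrow> real ^ 'n) \<Rightarrow> real \<Rightarrow> real ^ 'n \<Rightarrow> real ^ 'n" where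
  "flow D f t x = (THE y. \<exists>J u. ivp_solution D f x J u \<and> t \<in> J \<and> u t = y)"

definition exp_stable_on ::
  "(real ^ 'n \<Rightarrow> real) \<Rightarrow> (real ^ 'n) set \<Rightarrow> (real ^ 'n \<Rightarrow> real ^ 'n) \<Rightarrow> real ^ 'n \<Rightarrow>
   (real ^ 'n) set \<Rightarrow> real \<Rightarrow> real \<Rightarrow> bool" where
  "exp_stable_on nrm D f xs S C lam \<longleftrightarrow>
     (\<forall>x\<in>S. \<forall>t\<ge>0. t \<in> exist_interval D f x \<and>
        nrm (flow D f t x - xs) \<le> C * exp (- lam * t) * nrm (x - xs))"

definition containment_times ::
  "(real ^ 'n) set \<Rightarrow> (real ^ 'n \<Rightarrow> real ^ 'n) \<Rightarrow> (real ^ 'n) set \<Rightarrow> real ^ 'n \<Rightarrow> real \<Rightarrow> real set" where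
  "containment_times D f S x \<tau> =
     {t. 0 < t \<and> t \<le> \<tau> \<and> t \<in> exist_interval D f x \<and> flow D f t x \<in> S}"

definition is_ERLF ::
  "(real ^ 'n \<Rightarrow> real) \<Rightarrow> (real ^ 'n) set \<Rightarrow> (real ^ 'n \<Rightarrow> real ^ 'n) \<Rightarrow> real ^ 'n \<Rightarrow>
   (real ^ 'n) set \<Rightarrow> real \<Rightarrow> real \<Rightarrow> real \<Rightarrow> (real ^ 'n \<Rightarrow> real) \<Rightarrow> bool" where
  "is_ERLF nrm D f xs S \<epsilon> \<alpha> \<tau> V \<longleftrightarrow>
     0 \<le> \<epsilon> \<and> nball nrm xs \<epsilon> \<subseteq> interior S \<and> 0 < \<alpha> \<and> 0 < \<tau> \<and>
     continuous_on D V \<and> (\<forall>x\<in>D. 0 \<le> V x) \<and>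
     (\<exists>a1>0. \<exists>a2>0. \<forall>x\<in>S. a1 * nrm (x - xs) \<le> V x \<and> V x \<le> a2 * nrm (x - xs)) \<and>
     (\<forall>x\<in>closure (S - nball nrm xs \<epsilon>).
        \<exists>s\<in>containment_times D f S x \<tau>. exp (\<alpha> * s) * V (flow D f s x) \<le> V x)"

end

theory Submission
  imports Defs
begin

text \<open>The single time \<open>s = \<tau>\<close> works for every starting point: the bound on \<open>\<tau>\<close> says exactly that
  \<open>C exp (- (lam - \<alpha>) \<tau>) \<le> r / R\<close>. Hence \<open>exp (\<alpha> \<tau>)\<close> times the distance to the equilibrium at
  time \<open>\<tau>\<close> is at most \<open>r / R\<close> times the initial distance, which is at most \<open>R\<close>; so the trajectory
  is back in the \<open>r\<close>-ball, and the factor \<open>r / R \<le> 1\<close> gives the decrease.\<close>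

text \<open>Homogeneity and the triangle inequality make \<open>nrm\<close> convex, and a convex
  function on an open subset of a finite-dimensional space is continuous. This avoids comparing
  \<open>nrm\<close> with the Euclidean norm.\<close>

lemma is_norm_continuous_on:
  fixes nrm :: "real ^ 'n \<Rightarrow> real"
  assumes "is_norm nrm"
  shows "continuous_on A nrm"
proof -
  have "convex_on UNIV nrm"
  proof (rule convex_onI)
    fix t :: real and x y :: "real ^ 'n"
    assume t: "0 < t" "t < 1"
    have "nrm ((1 - t) *\<^sub>R x + t *\<^sub>R y) \<le> nrm ((1 - t) *\<^sub>R x) + nrm (t *\<^sub>R y)"
      using assms unfolding is_norm_def by blast
    also have "\<dots> = \<bar>1 - t\<bar> * nrm x + \<bar>t\<bar> * nrm y"
      using assms unfolding is_norm_def by metis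
    finally show "nrm ((1 - t) *\<^sub>R x + t *\<^sub>R y) \<le> (1 - t) * nrm x + t * nrm y"
      using t by simp
  qed simp
  then have "continuous_on UNIV nrm"
    by (intro convex_on_continuous open_UNIV)
  then show ?thesis
    by (rule continuous_on_subset) simp
qed

text \<open>A nonzero vector rescaled to norm exactly \<open>r\<close> gives a point of the first
  ball at distance \<open>r\<close> from the centre.\<close>

lemma nball_subset_imp_radius_le:
  fixes nrm :: "real ^ 'n \<Rightarrow> real"
  assumes "is_norm nrm" and "0 \<le> r" and sub: "nball nrm a r \<subseteq> nball nrm a R"
  shows "r \<le> R"
proof -
  \<comment> \<open>Index types are nonempty, so the dimension is at least 1; in dimension 0 all
    balls of nonnegative radius would coincide.\<close>
  obtain v :: "real ^ 'n" where "v \<noteq> 0"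
    by (metis nonzero_Basis nonempty_Basis ex_in_conv)
  then have v: "nrm v > 0"
    using assms(1) unfolding is_norm_def by (metis order_le_less)
  have "nrm ((r / nrm v) *\<^sub>R v) = \<bar>r / nrm v\<bar> * nrm v"
    using assms(1) unfolding is_norm_def by blast
  then have "nrm ((r / nrm v) *\<^sub>R v) = r"
    using v \<open>0 \<le> r\<close> by simp
  then show ?thesis
    using subsetD[OF sub, of "a + (r / nrm v) *\<^sub>R v"] by (simp add: nball_def)
qed

theorem theorem5:
  fixes nrm :: "real ^ 'n \<Rightarrow> real"
    and D S :: "(real ^ 'n) set"
    and f :: "real ^ 'n \<Rightarrow> real ^ 'n"
    and xs :: "real ^ 'n"
    and C lam r R \<alpha> \<epsilon> \<tau> :: real
  assumes "is_norm nrm"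
    and "open D"
    and "locally_lipschitz nrm D f"
    and "xs \<in> D" and "f xs = 0"
    and "compact S" and "S \<subseteq> D" and "xs \<in> interior S"
    and "C \<ge> 1" and "lam > 0"
    and "exp_stable_on nrm D f xs S C lam"
    and "r > 0" and "R > 0"
    and "nball nrm xs r \<subseteq> S" and "S \<subseteq> nball nrm xs R"
    and "0 < \<alpha>" and "\<alpha> < lam"
    and "\<epsilon> \<ge> 0" and "nball nrm xs \<epsilon> \<subseteq> interior S"
    and "\<tau> > 0"
    and "\<tau> \<ge> 1 / (lam - \<alpha>) * ln (C * (R / r))"
  shows "is_ERLF nrm D f xs S \<epsilon> \<alpha> \<tau> (\<lambda>x. nrm (x - xs))"
proof -
  have nonneg: "0 \<le> nrm x" for x
    using assms(1) unfolding is_norm_def by blast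
  have "r \<le> R"
    using nball_subset_imp_radius_le[of nrm r xs R] assms by auto
  have "ln (C * (R / r)) \<le> (lam - \<alpha>) * \<tau>"
    using assms(21) \<open>\<alpha> < lam\<close> by (simp add: field_simps)
  then have "exp (ln (C * (R / r))) \<le> exp ((lam - \<alpha>) * \<tau>)"
    by simp
  then have "C * (R / r) \<le> exp ((lam - \<alpha>) * \<tau>)"
    using \<open>C \<ge> 1\<close> \<open>r > 0\<close> \<open>R > 0\<close> by (subst (asm) exp_ln) auto
  then have "C * exp (- ((lam - \<alpha>) * \<tau>)) \<le> r / R"
    using \<open>r > 0\<close> \<open>R > 0\<close> unfolding exp_minus by (simp add: divide_simps mult.commute)
  \<comment> \<open>The weight at rate \<alpha> uses up part of the decay at rate
    \<open>lam\<close>, leaving the net rate \<open>lam - \<alpha>\<close>.\<close>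
  moreover have "exp (\<alpha> * \<tau>) * (C * exp (- lam * \<tau>)) = C * exp (- ((lam - \<alpha>) * \<tau>))"
    by (simp add: exp_add[symmetric] algebra_simps)
  ultimately have decay: "exp (\<alpha> * \<tau>) * (C * exp (- lam * \<tau>)) \<le> r / R"
    by metis
  have "continuous_on D (\<lambda>x. nrm (x - xs))"
    by (intro continuous_on_compose2[OF is_norm_continuous_on[OF assms(1), of UNIV]]
        continuous_intros) simp
  moreover have "\<tau> \<in> containment_times D f S x \<tau>
      \<and> exp (\<alpha> * \<tau>) * nrm (flow D f \<tau> x - xs) \<le> nrm (x - xs)"
    if "x \<in> closure (S - nball nrm xs \<epsilon>)" for x
  proof -
    \<comment> \<open>\<open>S\<close> is closed, so points added by the closure stay in
      \<open>S\<close>, where the stability estimate is available.\<close>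
    have "closure (S - nball nrm xs \<epsilon>) \<subseteq> S"
      using \<open>compact S\<close> by (intro closure_minimal compact_imp_closed) auto
    then have "x \<in> S"
      using that by blast
    then have ex: "\<tau> \<in> exist_interval D f x"
      and bd: "nrm (flow D f \<tau> x - xs) \<le> C * exp (- lam * \<tau>) * nrm (x - xs)"
      using assms(11) \<open>\<tau> > 0\<close> unfolding exp_stable_on_def by auto
    have "exp (\<alpha> * \<tau>) * nrm (flow D f \<tau> x - xs)
        \<le> exp (\<alpha> * \<tau>) * (C * exp (- lam * \<tau>) * nrm (x - xs))"
      using bd by (intro mult_left_mono) auto
    also have "\<dots> \<le> r / R * nrm (x - xs)"
      using mult_right_mono[OF decay nonneg, of "x - xs"] by (simp add: mult.assoc)
    finally have le: "exp (\<alpha> * \<tau>) * nrm (flow D f \<tau> x - xs) \<le> r / R * nrm (x - xs)" .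
    have "nrm (x - xs) \<le> R"
      using \<open>x \<in> S\<close> assms(15) by (auto simp: nball_def)
    then have "r / R * nrm (x - xs) \<le> r"
      using mult_left_mono[of "nrm (x - xs)" R "r / R"] \<open>r > 0\<close> \<open>R > 0\<close> by simp
    \<comment> \<open>The weight is at least 1, so the bound \<open>r\<close> on the weighted
      distance also bounds the distance itself.\<close>
    moreover have "nrm (flow D f \<tau> x - xs) \<le> exp (\<alpha> * \<tau>) * nrm (flow D f \<tau> x - xs)"
      using mult_right_mono[of 1 "exp (\<alpha> * \<tau>)", OF _ nonneg] \<open>0 < \<alpha>\<close> \<open>\<tau> > 0\<close> by simp
    ultimately have "flow D f \<tau> x \<in> S"
      using le assms(14) by (auto simp: nball_def)
    moreover have "r / R * nrm (x - xs) \<le> nrm (x - xs)"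
      using mult_right_mono[of "r / R" 1, OF _ nonneg] \<open>r \<le> R\<close> \<open>R > 0\<close> by simp
    ultimately show ?thesis
      using le ex \<open>\<tau> > 0\<close> by (simp add: containment_times_def)
  qed
  moreover have "\<exists>a1>0. \<exists>a2>0. \<forall>x\<in>S.
      a1 * nrm (x - xs) \<le> nrm (x - xs) \<and> nrm (x - xs) \<le> a2 * nrm (x - xs)"
    \<comment> \<open>The function is the distance itself, so 1 serves as both \<open>a1\<close> and
      \<open>a2\<close>.\<close>
    by (intro exI[of _ 1] conjI) simp_all
  ultimately show ?thesis
    unfolding is_ERLF_def using assms nonneg by blast
qed

end
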